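(* Let $S$ be a $\Gamma$-semigroup. The following are equivalent: (1) $S$ is regular and intra-regular; (2) every fuzzy quasi ideal of $S$ is idempotent; (3) every fuzzy bi-ideal of $S$ is idempotent.
   Context: Let $S$ and $\Gamma$ be non-empty sets. $S$ is a $\Gamma$-semigroup if there is a map $S\times\Gamma\times S\to S$, written $(a,\alpha,b)\mapsto a\alpha b$, with $(x\beta y)\gamma z=x\beta(y\gamma z)$ for all $x,y,z\in S$, $\beta,\gamma\in\Gamma$. $S$ is regular if for each $a\in S$ there exist $x\in S$ and $\alpha,\beta\in\Gamma$ with $a=a\alpha x\beta a$; $S$ is intra-regular if for each $a\in S$ there exist $x,y\in S$ and $\alpha,\beta,\gamma\in\Gamma$ with $a=x\alpha a\beta a\gamma y$. A fuzzy subset of $S$ is a function $\mu:S\to[0,1]$; it is non-empty if it is not identically $0$. For fuzzy subsets $\mu,\sigma$ of $S$: $(\mu\cap\sigma)(x)=\min\{\mu(x),\sigma(x)\}$; $(\mu\circ\sigma)(x)=\sup\{\min\{\mu(y),\sigma(z)\}: y,z\in S,\gamma\in\Gamma,\ x=y\gamma z\}$ if $x$ can be written as $y\gamma z$, and $(\mu\circ\sigma)(x)=0$ otherwise; $\mu\subseteq\sigma$ means $\mu(x)\le\sigma(x)$ for all $x\in S$. $\chi$ denotes the characteristic function of $S$ (constant $1$). A fuzzy subset $\mu$ is idempotent if $\mu\circ\mu=\mu$. A non-empty fuzzy subset $\mu$ is a fuzzy quasi ideal if $(\mu\circ\chi)\cap(\chi\circ\mu)\subseteq\mu$. A non-empty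 fuzzy subset $\mu$ is a fuzzy bi-ideal if $\mu(x\gamma y)\ge\min\{\mu(x),\mu(y)\}$ and $\mu(x\beta s\gamma y)\ge\min\{\mu(x),\mu(y)\}$ for all $x,s,y\in S$, $\beta,\gamma\in\Gamma$. *)

theory Defs
  imports Complex_Main "HOL-Library.FuncSet" "HOL-Library.Indicator_Function"
begin

locale gamma_semigroup =
  fixes S :: "'a set" and \<Gamma> :: "'g set" and mult :: "'a \<Rightarrow> 'g \<Rightarrow> 'a \<Rightarrow> 'a"
  assumes carrier_nonempty: "S \<noteq> {}"
    and operators_nonempty: "\<Gamma> \<noteq> {}"
    and mult_closed: "\<lbrakk>a \<in> S; \<alpha> \<in> \<Gamma>; b \<in> S\<rbrakk> \<Longrightarrow> mult a \<alpha> b \<in> S"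
    and mult_assoc: "\<lbrakk>x \<in> S; y \<in> S; z \<in> S; \<beta> \<in> \<Gamma>; \<gamma> \<in> \<Gamma>\<rbrakk>
      \<Longrightarrow> mult (mult x \<beta> y) \<gamma> z = mult x \<beta> (mult y \<gamma> z)"

definition gamma_regular :: "'a set \<Rightarrow> 'g set \<Rightarrow> ('a \<Rightarrow> 'g \<Rightarrow> 'a \<Rightarrow> 'a) \<Rightarrow> bool" where
  "gamma_regular S \<Gamma> mult \<longleftrightarrow>
    (\<forall>a\<in>S. \<exists>x\<in>S. \<exists>\<alpha>\<in>\<Gamma>. \<exists>\<beta>\<in>\<Gamma>. a = mult (mult a \<alpha> x) \<beta> a)"

definition gamma_intra_regular :: "'a set \<Rightarrow> 'g set \<Rightarrow> ('a \<Rightarrow> 'g \<Rightarrow> 'a \<Rightarrow> 'a) \<Rightarrow> bool" where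
  "gamma_intra_regular S \<Gamma> mult \<longleftrightarrow>
    (\<forall>a\<in>S. \<exists>x\<in>S. \<exists>y\<in>S. \<exists>\<alpha>\<in>\<Gamma>. \<exists>\<beta>\<in>\<Gamma>. \<exists>\<gamma>\<in>\<Gamma>.
      a = mult (mult (mult x \<alpha> a) \<beta> a) \<gamma> y)"

text \<open>
  A fuzzy subset of the carrier \<open>S\<close> is represented by a function on the ambient type that maps
  \<open>S\<close> into the unit interval. Its values outside \<open>S\<close> are irrelevant: inclusion, equality and
  non-emptiness of fuzzy subsets are all taken on \<open>S\<close> only, and the characteristic function of
  \<open>S\<close> is \<open>indicator S\<close>.
\<close>

definition fuzzy_subset :: "'a set \<Rightarrow> ('a \<Rightarrow> real) \<Rightarrow> bool" where
  "fuzzy_subset S \<mu> \<longleftrightarrow> \<mu> \<in> S \<rightarrow> {0..1}"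

definition fuzzy_nonempty :: "'a set \<Rightarrow> ('a \<Rightarrow> real) \<Rightarrow> bool" where
  "fuzzy_nonempty S \<mu> \<longleftrightarrow> (\<exists>x\<in>S. \<mu> x \<noteq> 0)"

definition fuzzy_le :: "'a set \<Rightarrow> ('a \<Rightarrow> real) \<Rightarrow> ('a \<Rightarrow> real) \<Rightarrow> bool" where
  "fuzzy_le S \<mu> \<sigma> \<longleftrightarrow> (\<forall>x\<in>S. \<mu> x \<le> \<sigma> x)"

definition fuzzy_eq :: "'a set \<Rightarrow> ('a \<Rightarrow> real) \<Rightarrow> ('a \<Rightarrow> real) \<Rightarrow> bool" where
  "fuzzy_eq S \<mu> \<sigma> \<longleftrightarrow> (\<forall>x\<in>S. \<mu> x = \<sigma> x)"

definition fuzzy_inter :: "('a \<Rightarrow> real) \<Rightarrow> ('a \<Rightarrow> real) \<Rightarrow> 'a \<Rightarrow> real" where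
  "fuzzy_inter \<mu> \<sigma> x = min (\<mu> x) (\<sigma> x)"

text \<open>
  For fuzzy subsets \<open>\<mu>\<close>, \<open>\<sigma>\<close> the set below lies in the unit interval, so the real supremum
  is the intended one whenever \<open>x\<close> is decomposable.
\<close>

definition fuzzy_comp ::
  "'a set \<Rightarrow> 'g set \<Rightarrow> ('a \<Rightarrow> 'g \<Rightarrow> 'a \<Rightarrow> 'a) \<Rightarrow> ('a \<Rightarrow> real) \<Rightarrow> ('a \<Rightarrow> real) \<Rightarrow> 'a \<Rightarrow> real" where
  "fuzzy_comp S \<Gamma> mult \<mu> \<sigma> x =
    (if \<exists>y\<in>S. \<exists>\<gamma>\<in>\<Gamma>. \<exists>z\<in>S. x = mult y \<gamma> z
     then Sup {min (\<mu> y) (\<sigma> z) | y \<gamma> z. y \<in> S \<and> \<gamma> \<in> \<Gamma> \<and> z \<in> S \<and> x = mult y \<gamma> z}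
     else 0)"

definition fuzzy_idempotent ::
  "'a set \<Rightarrow> 'g set \<Rightarrow> ('a \<Rightarrow> 'g \<Rightarrow> 'a \<Rightarrow> 'a) \<Rightarrow> ('a \<Rightarrow> real) \<Rightarrow> bool" where
  "fuzzy_idempotent S \<Gamma> mult \<mu> \<longleftrightarrow> fuzzy_eq S (fuzzy_comp S \<Gamma> mult \<mu> \<mu>) \<mu>"

definition fuzzy_quasi_ideal ::
  "'a set \<Rightarrow> 'g set \<Rightarrow> ('a \<Rightarrow> 'g \<Rightarrow> 'a \<Rightarrow> 'a) \<Rightarrow> ('a \<Rightarrow> real) \<Rightarrow> bool" where
  "fuzzy_quasi_ideal S \<Gamma> mult \<mu> \<longleftrightarrow>
    fuzzy_subset S \<mu> \<and> fuzzy_nonempty S \<mu> \<and>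
    fuzzy_le S
      (fuzzy_inter (fuzzy_comp S \<Gamma> mult \<mu> (indicator S)) (fuzzy_comp S \<Gamma> mult (indicator S) \<mu>)) \<mu>"

definition fuzzy_bi_ideal ::
  "'a set \<Rightarrow> 'g set \<Rightarrow> ('a \<Rightarrow> 'g \<Rightarrow> 'a \<Rightarrow> 'a) \<Rightarrow> ('a \<Rightarrow> real) \<Rightarrow> bool" where
  "fuzzy_bi_ideal S \<Gamma> mult \<mu> \<longleftrightarrow>
    fuzzy_subset S \<mu> \<and> fuzzy_nonempty S \<mu> \<and>
    (\<forall>x\<in>S. \<forall>y\<in>S. \<forall>\<gamma>\<in>\<Gamma>. \<mu> (mult x \<gamma> y) \<ge> min (\<mu> x) (\<mu> y)) \<and>
    (\<forall>x\<in>S. \<forall>s\<in>S. \<forall>y\<in>S. \<forall>\<beta>\<in>\<Gamma>. \<forall>\<gamma>\<in>\<Gamma>.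
      \<mu> (mult (mult x \<beta> s) \<gamma> y) \<ge> min (\<mu> x) (\<mu> y))"

end

theory Submission
  imports Defs
begin

text \<open>
  If \<open>S\<close> is regular and intra-regular, every \<open>a\<close> is a product of two elements of the form \<open>a s a\<close>, on
  which a fuzzy bi-ideal is at least as large as at \<open>a\<close>. Conversely, let \<open>Q\<close> be the quasi ideal
  generated by \<open>a\<close>. Its characteristic function is a fuzzy quasi ideal; if it is idempotent then
  \<open>Q \<subseteq> Q\<Gamma>Q\<close>, so \<open>a\<close> is a product of three and of four elements of \<open>Q\<close>. Such an element can be
  replaced by \<open>a\<close> at the cost of changing a neighbouring factor: doing so with the outer two of the
  three factors gives regularity, with the middle two of the four intra-regularity.
\<close>

text \<open>The bound \<open>0 \<le> c\<close> covers the default value 0 of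
  \<open>fuzzy_comp\<close> at elements that are not products.\<close>

lemma fuzzy_comp_least:
  assumes "0 \<le> c"
    and "\<And>y \<gamma> z. \<lbrakk>y \<in> S; \<gamma> \<in> \<Gamma>; z \<in> S; x = mult y \<gamma> z\<rbrakk> \<Longrightarrow> min (\<mu> y) (\<sigma> z) \<le> c"
  shows "fuzzy_comp S \<Gamma> mult \<mu> \<sigma> x \<le> c"
proof (cases "\<exists>y\<in>S. \<exists>\<gamma>\<in>\<Gamma>. \<exists>z\<in>S. x = mult y \<gamma> z")
  case True
  then have "Sup {min (\<mu> y) (\<sigma> z) | y \<gamma> z. y \<in> S \<and> \<gamma> \<in> \<Gamma> \<and> z \<in> S \<and> x = mult y \<gamma> z} \<le> c"
    using assms(2) by (intro cSup_least) auto
  with True show ?thesis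
    unfolding fuzzy_comp_def by simp
next
  case False
  then show ?thesis
    unfolding fuzzy_comp_def using assms(1) by simp
qed

text \<open>A real supremum dominates its set only when that set is bounded above. Here each minimum
  is at most its first argument, hence at most 1.\<close>

lemma fuzzy_comp_upper:
  assumes "fuzzy_subset S \<mu>" and "y \<in> S" "\<gamma> \<in> \<Gamma>" "z \<in> S"
  shows "min (\<mu> y) (\<sigma> z) \<le> fuzzy_comp S \<Gamma> mult \<mu> \<sigma> (mult y \<gamma> z)"
proof -
  let ?A = "{min (\<mu> y') (\<sigma> z') | y' \<gamma>' z'.
    y' \<in> S \<and> \<gamma>' \<in> \<Gamma> \<and> z' \<in> S \<and> mult y \<gamma> z = mult y' \<gamma>' z'}"
  have "bdd_above ?A"
    using assms(1) unfolding fuzzy_subset_def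
    by (intro bdd_aboveI[where M = 1]) (auto simp: Pi_iff min_le_iff_disj)
  moreover have "min (\<mu> y) (\<sigma> z) \<in> ?A"
    using assms by blast
  ultimately have "min (\<mu> y) (\<sigma> z) \<le> Sup ?A"
    by (rule cSup_upper[rotated])
  then show ?thesis
    unfolding fuzzy_comp_def using assms(2-4) by auto
qed

lemma fuzzy_subset_indicator: "fuzzy_subset S (indicator A)"
  by (auto simp: fuzzy_subset_def indicator_def)

text \<open>The composition has value 1 at \<open>x\<close>; if every factorization of
  \<open>x\<close> had a factor outside \<open>Q\<close>, all the minima would be 0.\<close>

lemma fuzzy_idempotent_indicatorD:
  assumes "fuzzy_idempotent S \<Gamma> mult (indicator Q)" and "x \<in> Q" "Q \<subseteq> S"
  shows "\<exists>p\<in>Q. \<exists>\<gamma>\<in>\<Gamma>. \<exists>q\<in>Q. x = mult p \<gamma> q"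
proof (rule ccontr)
  assume *: "\<not> ?thesis"
  have "fuzzy_comp S \<Gamma> mult (indicator Q) (indicator Q) x \<le> 0"
    using * by (intro fuzzy_comp_least) (auto simp: indicator_def)
  moreover have "fuzzy_comp S \<Gamma> mult (indicator Q) (indicator Q) x = 1"
    using assms unfolding fuzzy_idempotent_def fuzzy_eq_def by auto
  ultimately show False
    by simp
qed

context gamma_semigroup
begin

text \<open>At a product with left factor \<open>x\<close> and right factor \<open>y\<close>,
  composing \<open>\<mu>\<close> with the indicator of \<open>S\<close> on the right gives at least
  \<open>\<mu> x\<close>, on the left at least \<open>\<mu> y\<close>. The quasi ideal inequality
  passes the minimum on to \<open>\<mu>\<close>.\<close>

lemma fuzzy_quasi_ideal_imp_bi_ideal:
  assumes "fuzzy_quasi_ideal S \<Gamma> mult \<mu>"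
  shows "fuzzy_bi_ideal S \<Gamma> mult \<mu>"
proof -
  have sub: "fuzzy_subset S \<mu>"
    and le: "\<And>w. w \<in> S \<Longrightarrow> min (fuzzy_comp S \<Gamma> mult \<mu> (indicator S) w)
      (fuzzy_comp S \<Gamma> mult (indicator S) \<mu> w) \<le> \<mu> w"
    using assms unfolding fuzzy_quasi_ideal_def fuzzy_le_def fuzzy_inter_def by auto
  have left: "\<mu> x \<le> fuzzy_comp S \<Gamma> mult \<mu> (indicator S) (mult x \<gamma> s)"
    if "x \<in> S" "\<gamma> \<in> \<Gamma>" "s \<in> S" for x \<gamma> s
  proof -
    \<comment> \<open>Hence the minimum of \<open>\<mu> x\<close> and
      \<open>indicator S s = 1\<close> is \<open>\<mu> x\<close> itself.\<close>
    have "\<mu> x \<le> 1"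
      using sub that unfolding fuzzy_subset_def by (auto simp: Pi_iff)
    then show ?thesis
      using fuzzy_comp_upper[OF sub that, of "indicator S" mult] that by simp
  qed
  have right: "\<mu> x \<le> fuzzy_comp S \<Gamma> mult (indicator S) \<mu> (mult s \<gamma> x)"
    if "s \<in> S" "\<gamma> \<in> \<Gamma>" "x \<in> S" for x \<gamma> s
  proof -
    have "\<mu> x \<le> 1"
      using sub that unfolding fuzzy_subset_def by (auto simp: Pi_iff)
    then show ?thesis
      using fuzzy_comp_upper[OF fuzzy_subset_indicator that, of S \<mu> mult] that by simp
  qed
  have "min (\<mu> x) (\<mu> y) \<le> \<mu> (mult x \<gamma> y)" if "x \<in> S" "y \<in> S" "\<gamma> \<in> \<Gamma>" for x y \<gamma>
    using left[of x \<gamma> y] right[of x \<gamma> y] le[of "mult x \<gamma> y"] mult_closed that by fastforce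
  moreover have "min (\<mu> x) (\<mu> y) \<le> \<mu> (mult (mult x \<beta> s) \<gamma> y)"
    if "x \<in> S" "s \<in> S" "y \<in> S" "\<beta> \<in> \<Gamma>" "\<gamma> \<in> \<Gamma>" for x s y \<beta> \<gamma>
  proof -
    \<comment> \<open>One bracketing shows \<open>x\<close> as left factor, the other
      \<open>y\<close> as right factor; \<open>left\<close> and \<open>right\<close> use one
      each.\<close>
    have "mult (mult x \<beta> s) \<gamma> y = mult x \<beta> (mult s \<gamma> y)"
      using that by (simp add: mult_assoc)
    then show ?thesis
      using left[of x \<beta> "mult s \<gamma> y"] right[of "mult x \<beta> s" \<gamma> y]
        le[of "mult (mult x \<beta> s) \<gamma> y"] mult_closed that by fastforce
  qed
  ultimately show ?thesis
    using assms unfolding fuzzy_bi_ideal_def fuzzy_quasi_ideal_def by blast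
qed

text \<open>Regularity applied twice gives \<open>a = axaxa\<close>. Replacing the middle
  \<open>a\<close> by \<open>yaaz\<close> splits this into \<open>a(xy)a\<close> times
  \<open>a(zx)a\<close>.\<close>

lemma regular_intra_regular_decomposition:
  assumes "gamma_regular S \<Gamma> mult" "gamma_intra_regular S \<Gamma> mult" and a: "a \<in> S"
  shows "\<exists>s\<in>S. \<exists>t\<in>S. \<exists>\<alpha>\<in>\<Gamma>. \<exists>\<beta>\<in>\<Gamma>. \<exists>\<gamma>\<in>\<Gamma>. \<exists>\<delta>\<in>\<Gamma>. \<exists>\<epsilon>\<in>\<Gamma>.
    a = mult (mult (mult a \<alpha> s) \<beta> a) \<gamma> (mult (mult a \<delta> t) \<epsilon> a)"
proof -
  obtain x \<alpha> \<beta> where x: "x \<in> S" "\<alpha> \<in> \<Gamma>" "\<beta> \<in> \<Gamma>" and ax: "a = mult (mult a \<alpha> x) \<beta> a"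
    using assms unfolding gamma_regular_def by blast
  obtain y z \<gamma> \<delta> \<epsilon> where yz: "y \<in> S" "z \<in> S" "\<gamma> \<in> \<Gamma>" "\<delta> \<in> \<Gamma>" "\<epsilon> \<in> \<Gamma>"
    and ayz: "a = mult (mult (mult y \<gamma> a) \<delta> a) \<epsilon> z"
    using assms unfolding gamma_intra_regular_def by blast
  note ax
  also have "mult (mult a \<alpha> x) \<beta> a = mult (mult a \<alpha> x) \<beta> (mult (mult a \<alpha> x) \<beta> a)"
    by (rule arg_cong[OF ax])
  also have "\<dots> = mult (mult a \<alpha> x) \<beta>
      (mult (mult (mult (mult (mult y \<gamma> a) \<delta> a) \<epsilon> z) \<alpha> x) \<beta> a)"
    \<comment> \<open>The explicit context selects the middle \<open>a\<close>; the outer two stay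
      as the ends of the new factors.\<close>
    by (rule arg_cong[where f = "\<lambda>u. mult (mult a \<alpha> x) \<beta> (mult (mult u \<alpha> x) \<beta> a)", OF ayz])
  also have "\<dots> = mult (mult (mult a \<alpha> (mult x \<beta> y)) \<gamma> a) \<delta> (mult (mult a \<epsilon> (mult z \<alpha> x)) \<beta> a)"
    using a x yz by (simp add: mult_assoc mult_closed)
  finally show ?thesis
    using x yz mult_closed by blast
qed

lemma fuzzy_bi_ideal_idempotent:
  assumes "gamma_regular S \<Gamma> mult" "gamma_intra_regular S \<Gamma> mult"
    and bi: "fuzzy_bi_ideal S \<Gamma> mult \<mu>"
  shows "fuzzy_idempotent S \<Gamma> mult \<mu>"
  unfolding fuzzy_idempotent_def fuzzy_eq_def
proof (intro ballI antisym)
  fix a assume a: "a \<in> S"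
  have sub: "fuzzy_subset S \<mu>"
    and prod2: "\<And>x y \<gamma>. \<lbrakk>x \<in> S; y \<in> S; \<gamma> \<in> \<Gamma>\<rbrakk> \<Longrightarrow> min (\<mu> x) (\<mu> y) \<le> \<mu> (mult x \<gamma> y)"
    and prod3: "\<And>x s y \<beta> \<gamma>. \<lbrakk>x \<in> S; s \<in> S; y \<in> S; \<beta> \<in> \<Gamma>; \<gamma> \<in> \<Gamma>\<rbrakk>
      \<Longrightarrow> min (\<mu> x) (\<mu> y) \<le> \<mu> (mult (mult x \<beta> s) \<gamma> y)"
    using bi unfolding fuzzy_bi_ideal_def by auto
  have "0 \<le> \<mu> a"
    using sub a unfolding fuzzy_subset_def by auto
  then show "fuzzy_comp S \<Gamma> mult \<mu> \<mu> a \<le> \<mu> a"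
    using prod2 by (intro fuzzy_comp_least) auto
  obtain s t \<alpha> \<beta> \<gamma> \<delta> \<epsilon> where st: "s \<in> S" "t \<in> S" "\<alpha> \<in> \<Gamma>" "\<beta> \<in> \<Gamma>" "\<gamma> \<in> \<Gamma>" "\<delta> \<in> \<Gamma>" "\<epsilon> \<in> \<Gamma>"
    and eq: "a = mult (mult (mult a \<alpha> s) \<beta> a) \<gamma> (mult (mult a \<delta> t) \<epsilon> a)"
    using regular_intra_regular_decomposition[OF assms(1,2) a] by blast
  let ?p = "mult (mult a \<alpha> s) \<beta> a" and ?q = "mult (mult a \<delta> t) \<epsilon> a"
  \<comment> \<open>Both factors begin and end with \<open>a\<close>, so \<open>prod3\<close> bounds
    them below by \<open>min (\<mu> a) (\<mu> a)\<close>.\<close>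
  have "\<mu> a \<le> min (\<mu> ?p) (\<mu> ?q)"
    using prod3[of a s a \<alpha> \<beta>] prod3[of a t a \<delta> \<epsilon>] a st by simp
  also have "\<dots> \<le> fuzzy_comp S \<Gamma> mult \<mu> \<mu> (mult ?p \<gamma> ?q)"
    using a st by (intro fuzzy_comp_upper sub) (auto intro: mult_closed)
  finally show "\<mu> a \<le> fuzzy_comp S \<Gamma> mult \<mu> \<mu> a"
    by (simp only: eq[symmetric])
qed

text \<open>Without an identity, \<open>a\<close> need not lie in the intersection of
  \<open>a\<Gamma>S\<close> and \<open>S\<Gamma>a\<close>, so it is inserted.\<close>

definition principal_quasi_ideal :: "'a \<Rightarrow> 'a set" where
  "principal_quasi_ideal a = insert a
    ({mult a \<gamma> s | \<gamma> s. \<gamma> \<in> \<Gamma> \<and> s \<in> S} \<inter> {mult s \<gamma> a | s \<gamma>. s \<in> S \<and> \<gamma> \<in> \<Gamma>})"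

lemma principal_quasi_ideal_self: "a \<in> principal_quasi_ideal a"
  by (simp add: principal_quasi_ideal_def)

lemma principal_quasi_ideal_subset: "a \<in> S \<Longrightarrow> principal_quasi_ideal a \<subseteq> S"
  by (auto simp: principal_quasi_ideal_def mult_closed)

text \<open>Either \<open>p\<close> is \<open>a\<close>, or it begins with \<open>a\<close> and its
  remainder is absorbed into \<open>c\<close>.\<close>

lemma principal_quasi_ideal_mult_right:
  assumes "a \<in> S" "p \<in> principal_quasi_ideal a" "\<gamma> \<in> \<Gamma>" "c \<in> S"
  shows "\<exists>\<delta>\<in>\<Gamma>. \<exists>d\<in>S. mult p \<gamma> c = mult a \<delta> d"
proof -
  consider "p = a" | \<delta> s where "\<delta> \<in> \<Gamma>" "s \<in> S" "p = mult a \<delta> s"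
    using assms(2) by (auto simp: principal_quasi_ideal_def)
  then show ?thesis
  proof cases
    case 2
    then have "mult p \<gamma> c = mult a \<delta> (mult s \<gamma> c)"
      using assms by (simp add: mult_assoc)
    then show ?thesis
      using 2 assms mult_closed by blast
  qed (use assms in blast)
qed

lemma principal_quasi_ideal_mult_left:
  assumes "a \<in> S" "p \<in> principal_quasi_ideal a" "\<gamma> \<in> \<Gamma>" "c \<in> S"
  shows "\<exists>d\<in>S. \<exists>\<delta>\<in>\<Gamma>. mult c \<gamma> p = mult d \<delta> a"
proof -
  consider "p = a" | s \<delta> where "s \<in> S" "\<delta> \<in> \<Gamma>" "p = mult s \<delta> a"
    using assms(2) by (auto simp: principal_quasi_ideal_def)
  then show ?thesis
  proof cases
    case 2
    then have "mult c \<gamma> p = mult (mult c \<gamma> s) \<delta> a"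
      using assms by (simp add: mult_assoc)
    then show ?thesis
      using 2 assms mult_closed by blast
  qed (use assms in blast)
qed

text \<open>Outside \<open>Q\<close> an element misses \<open>a\<Gamma>S\<close> or
  \<open>S\<Gamma>a\<close>. These contain \<open>Q\<Gamma>S\<close> and \<open>S\<Gamma>Q\<close>,
  so one of the two compositions is at most 0 there.\<close>

lemma fuzzy_quasi_ideal_indicator:
  assumes a: "a \<in> S"
  shows "fuzzy_quasi_ideal S \<Gamma> mult (indicator (principal_quasi_ideal a))"
proof -
  let ?Q = "principal_quasi_ideal a"
  let ?\<chi> = "indicator ?Q :: 'a \<Rightarrow> real"
  have "min (fuzzy_comp S \<Gamma> mult ?\<chi> (indicator S) x) (fuzzy_comp S \<Gamma> mult (indicator S) ?\<chi> x) \<le> ?\<chi> x"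
    for x
  proof (cases "x \<in> ?Q")
    case True
    have "fuzzy_comp S \<Gamma> mult ?\<chi> (indicator S) x \<le> 1"
      by (intro fuzzy_comp_least) (auto simp: indicator_def)
    with True show ?thesis
      by simp
  next
    case False
    then consider "\<not> (\<exists>\<gamma>\<in>\<Gamma>. \<exists>s\<in>S. x = mult a \<gamma> s)" | "\<not> (\<exists>s\<in>S. \<exists>\<gamma>\<in>\<Gamma>. x = mult s \<gamma> a)"
      unfolding principal_quasi_ideal_def by blast
    then show ?thesis
    proof cases
      case 1
      then have "y \<notin> ?Q" if "\<gamma> \<in> \<Gamma>" "z \<in> S" "x = mult y \<gamma> z" for y \<gamma> z
        using principal_quasi_ideal_mult_right[OF a] that by blast
      then have "fuzzy_comp S \<Gamma> mult ?\<chi> (indicator S) x \<le> 0"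
        by (intro fuzzy_comp_least) auto
      with False show ?thesis
        by simp
    next
      case 2
      then have "z \<notin> ?Q" if "\<gamma> \<in> \<Gamma>" "y \<in> S" "x = mult y \<gamma> z" for y \<gamma> z
        using principal_quasi_ideal_mult_left[OF a] that by blast
      then have "fuzzy_comp S \<Gamma> mult (indicator S) ?\<chi> x \<le> 0"
        by (intro fuzzy_comp_least) auto
      with False show ?thesis
        by simp
    qed
  qed
  moreover have "fuzzy_nonempty S ?\<chi>"
    unfolding fuzzy_nonempty_def using a principal_quasi_ideal_self by (intro bexI[of _ a]) auto
  ultimately show ?thesis
    unfolding fuzzy_quasi_ideal_def fuzzy_le_def fuzzy_inter_def
    by (simp add: fuzzy_subset_indicator)
qed

lemma regular_intra_regular_if_quasi_ideals_idempotent: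
  assumes idem: "\<And>\<mu>. fuzzy_quasi_ideal S \<Gamma> mult \<mu> \<Longrightarrow> fuzzy_idempotent S \<Gamma> mult \<mu>"
  shows "gamma_regular S \<Gamma> mult" "gamma_intra_regular S \<Gamma> mult"
proof -
  have "(\<exists>x\<in>S. \<exists>\<alpha>\<in>\<Gamma>. \<exists>\<beta>\<in>\<Gamma>. a = mult (mult a \<alpha> x) \<beta> a) \<and>
    (\<exists>x\<in>S. \<exists>y\<in>S. \<exists>\<alpha>\<in>\<Gamma>. \<exists>\<beta>\<in>\<Gamma>. \<exists>\<gamma>\<in>\<Gamma>. a = mult (mult (mult x \<alpha> a) \<beta> a) \<gamma> y)"
    if a: "a \<in> S" for a
  proof -
    let ?Q = "principal_quasi_ideal a"
    have sub: "?Q \<subseteq> S"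
      by (rule principal_quasi_ideal_subset[OF a])
    have decomp: "\<exists>p\<in>?Q. \<exists>\<gamma>\<in>\<Gamma>. \<exists>q\<in>?Q. x = mult p \<gamma> q" if "x \<in> ?Q" for x
      using fuzzy_idempotent_indicatorD[OF idem[OF fuzzy_quasi_ideal_indicator[OF a]] that sub] .
    \<comment> \<open>Splitting \<open>a\<close>, then both its factors, gives \<open>a = pq\<close>
      with \<open>p = p1 p2\<close> and \<open>q = q1 q2\<close>.\<close>
    obtain p q \<delta> where pq: "p \<in> ?Q" "\<delta> \<in> \<Gamma>" "q \<in> ?Q" "a = mult p \<delta> q"
      using decomp[OF principal_quasi_ideal_self] by blast
    obtain p1 \<gamma> p2 where p: "p1 \<in> ?Q" "\<gamma> \<in> \<Gamma>" "p2 \<in> ?Q" "p = mult p1 \<gamma> p2"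
      using decomp[OF pq(1)] by blast
    obtain q1 \<epsilon> q2 where q: "q1 \<in> ?Q" "\<epsilon> \<in> \<Gamma>" "q2 \<in> ?Q" "q = mult q1 \<epsilon> q2"
      using decomp[OF pq(3)] by blast
    note S = subsetD[OF sub]
    \<comment> \<open>Regularity, from the factors \<open>p1\<close>, \<open>p2\<close>,
      \<open>q\<close>: \<open>p1\<close> becomes \<open>a\<close> and turns \<open>p2\<close> into
      \<open>d\<close>, then \<open>q\<close> becomes \<open>a\<close> and turns \<open>d\<close>
      into \<open>e\<close>.\<close>
    obtain \<alpha> d where d: "\<alpha> \<in> \<Gamma>" "d \<in> S" "p = mult a \<alpha> d"
      using principal_quasi_ideal_mult_right[OF a p(1,2) S[OF p(3)]] p(4) by auto
    obtain e \<beta> where e: "e \<in> S" "\<beta> \<in> \<Gamma>" "mult d \<delta> q = mult e \<beta> a"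
      using principal_quasi_ideal_mult_left[OF a pq(3,2) d(2)] by auto
    have "mult p \<delta> q = mult a \<alpha> (mult d \<delta> q)"
      unfolding d(3) using pq(2) d(1,2) a S[OF pq(3)] by (simp add: mult_assoc)
    also have "\<dots> = mult (mult a \<alpha> e) \<beta> a"
      unfolding e(3) using e(1,2) d(1) a by (simp add: mult_assoc)
    finally have "a = mult (mult a \<alpha> e) \<beta> a"
      by (rule trans[OF pq(4)])
    \<comment> \<open>Intra-regularity: \<open>p2\<close> and \<open>q1\<close> become
      \<open>a\<close>, while \<open>p1\<close> and \<open>q2\<close> turn into \<open>x\<close> and
      \<open>y\<close>.\<close>
    moreover obtain x \<alpha>' where x: "x \<in> S" "\<alpha>' \<in> \<Gamma>" "p = mult x \<alpha>' a"
      using principal_quasi_ideal_mult_left[OF a p(3,2) S[OF p(1)]] p(4) by auto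
    obtain \<beta>' y where y: "\<beta>' \<in> \<Gamma>" "y \<in> S" "q = mult a \<beta>' y"
      using principal_quasi_ideal_mult_right[OF a q(1,2) S[OF q(3)]] q(4) by auto
    have "mult p \<delta> q = mult (mult (mult x \<alpha>' a) \<delta> a) \<beta>' y"
      unfolding x(3) y(3) using x(1,2) y(1,2) pq(2) a by (simp add: mult_assoc mult_closed)
    then have "a = mult (mult (mult x \<alpha>' a) \<delta> a) \<beta>' y"
      by (rule trans[OF pq(4)])
    ultimately show ?thesis
      using x(1,2) y(1,2) pq(2) d(1) e(1,2) by blast
  qed
  then show "gamma_regular S \<Gamma> mult" "gamma_intra_regular S \<Gamma> mult"
    unfolding gamma_regular_def gamma_intra_regular_def by blast+
qed

end

theorem theorem5p16:
  fixes S :: "'a set" and \<Gamma> :: "'g set" and mult :: "'a \<Rightarrow> 'g \<Rightarrow> 'a \<Rightarrow> 'a"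
  assumes "gamma_semigroup S \<Gamma> mult"
  shows "((gamma_regular S \<Gamma> mult \<and> gamma_intra_regular S \<Gamma> mult) \<longleftrightarrow>
          (\<forall>\<mu>. fuzzy_quasi_ideal S \<Gamma> mult \<mu> \<longrightarrow> fuzzy_idempotent S \<Gamma> mult \<mu>)) \<and>
         ((\<forall>\<mu>. fuzzy_quasi_ideal S \<Gamma> mult \<mu> \<longrightarrow> fuzzy_idempotent S \<Gamma> mult \<mu>) \<longleftrightarrow>
          (\<forall>\<mu>. fuzzy_bi_ideal S \<Gamma> mult \<mu> \<longrightarrow> fuzzy_idempotent S \<Gamma> mult \<mu>))"
proof -
  interpret gamma_semigroup S \<Gamma> mult
    by (rule assms)
  \<comment> \<open>The cycle: (1) gives (3), (3) gives (2) since quasi ideals are bi-ideals, and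
    (2) gives (1).\<close>
  show ?thesis
    using fuzzy_quasi_ideal_imp_bi_ideal fuzzy_bi_ideal_idempotent
      regular_intra_regular_if_quasi_ideals_idempotent by blast
qed

end
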